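(* Let $s$ and $d$ be coprime positive integers. There is a bijection between the set $\mathcal{BC}_{(s,s+d,s+2d)}$ of $(\overline{s},\overline{s+d},\overline{s+2d})$-core partitions and (a) $\mathcal{F}\left(\frac{s+d+1}{2},-\frac{d}{2} \,;\, \{U\},\{D\}\right)$ if $s$ is odd and $d$ is even; (b) $\mathcal{F}\left(\frac{s+d+2}{2},-\frac{d+1}{2} \,;\, \{U\},\{FD,DD,U\}\right)$ if both $s$ and $d$ are odd; (c) $\mathcal{F}\left(\frac{s+d+1}{2},-\frac{d+1}{2} \,;\, \{U\},\emptyset\right)$ if $s$ is even and $d$ is odd.
   Context: A strict partition $\lambda=(\lambda_1>\lambda_2>\cdots>\lambda_\ell)$ is a finite (possibly empty) strictly decreasing sequence of positive integers. The bar lengths in the $i$th row of $\lambda$ are the elements of $\{\lambda_i+\lambda_{i+1},\dots,\lambda_i+\lambda_\ell\}\cup\big(\{1,2,\dots,\lambda_i\}\setminus\{\lambda_i-\lambda_{i+1},\dots,\lambda_i-\lambda_\ell\}\big)$. $\lambda$ is an $\overline{s}$-core if $s$ is not a bar length in any row of $\lambda$. $\mathcal{BC}_{(s_1,s_2,s_3)}$ is the set of strict partitions that are $\overline{s_k}$-cores for all $k=1,2,3$ (the empty partition included). A free Motzkin path of type $(m,n)$ is a path from $(0,0)$ to $(m,n)$ consisting of steps $U=(1,1)$, $F=(1,0)$, $D=(1,-1)$. For sets $A,B$ of finite sequences of steps, $\mathcal{F}(m,n\,;\,A,B)$ is the set of free Motzkin paths of type $(m,n)$ that do not start with any sequence in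 $A$ and do not end with any sequence in $B$. *)

theory Defs
  imports Main "HOL-Library.Sublist" "HOL-Library.Product_Plus"
begin

definition strict_partition :: "nat list \<Rightarrow> bool" where
  "strict_partition l \<longleftrightarrow> sorted_wrt (>) l \<and> (\<forall>x\<in>set l. x > 0)"

text \<open>Rows are indexed from 0. The truncated subtraction on \<open>nat\<close> is exact whenever \<open>l\<close> is
  strictly decreasing.\<close>

definition bar_lengths :: "nat list \<Rightarrow> nat \<Rightarrow> nat set" where
  "bar_lengths l i =
     {l ! i + l ! j | j. i < j \<and> j < length l} \<union>
     ({1..l ! i} - {l ! i - l ! j | j. i < j \<and> j < length l})"

definition bar_core :: "nat \<Rightarrow> nat list \<Rightarrow> bool" where
  "bar_core s l \<longleftrightarrow> strict_partition l \<and> (\<forall>i<length l. s \<notin> bar_lengths l i)"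

definition BC :: "nat \<Rightarrow> nat \<Rightarrow> nat \<Rightarrow> nat list set" where
  "BC s1 s2 s3 = {l. bar_core s1 l \<and> bar_core s2 l \<and> bar_core s3 l}"

datatype step = U | F | D

fun step_vec :: "step \<Rightarrow> int \<times> int" where
  "step_vec U = (1, 1)"
| "step_vec F = (1, 0)"
| "step_vec D = (1, -1)"

text \<open>A path starting at the origin is given by its sequence of steps.\<close>

definition free_motzkin_path :: "int \<Rightarrow> int \<Rightarrow> step list \<Rightarrow> bool" where
  "free_motzkin_path m n p \<longleftrightarrow> sum_list (map step_vec p) = (m, n)"

definition motzkin_paths_avoiding ::
    "int \<Rightarrow> int \<Rightarrow> step list set \<Rightarrow> step list set \<Rightarrow> step list set" where
  "motzkin_paths_avoiding m n A B =
     {p. free_motzkin_path m n p \<and> (\<forall>a\<in>A. \<not> prefix a p) \<and> (\<forall>b\<in>B. \<not> suffix b p)}"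

end

theory Submission
  imports Defs
begin

text \<open>Write \<open>t = s + d\<close>, so that the three bar lengths are \<open>t - d\<close>, \<open>t\<close> and \<open>t + d\<close>. A set \<open>X\<close> of parts is
  encoded by the set \<open>maya X\<close> of integers that contains a positive \<open>n\<close> when \<open>n\<close> is a part and
  a negative \<open>n\<close> when \<open>- n\<close> is not a part. Removing a bar of length \<open>c\<close>, whether it shortens or deletes
  one part or deletes two parts of sum \<open>c\<close>, then is the single move \<open>n \<mapsto> n - c\<close>, and being a bar core
  for \<open>c\<close> says that \<open>maya X\<close> is closed under this move. The only exception is
  \<open>n = c / 2\<close>, whose move ends at \<open>- n\<close>: a single part \<open>c / 2\<close> is not a bar of length \<open>c\<close>
  (\<open>bar_core_iff_core_set\<close>).

  As \<open>d\<close> and \<open>t\<close> are coprime, every integer has the form \<open>d * j + t * l\<close>. Closure under \<open>t\<close> says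
  that in each column \<open>j\<close> the set consists of the levels \<open>l \<le> h j\<close>, for a function \<open>h\<close> on the
  integers, here called a charge. Since \<open>(j, l)\<close> and \<open>(j + t, l - d)\<close> name the same integer,
  \<open>h (j + t) = h j - d\<close>; and since \<open>maya X\<close> is antisymmetric, \<open>h (- j) = - 1 - h j\<close> except in
  the column of \<open>0\<close>. The moves by \<open>t - d\<close> and \<open>t + d\<close> lower the level by \<open>1\<close> and change the column by
  \<open>1\<close> and \<open>- 1\<close>, so closure under both means \<open>\<bar>h (j + 1) - h j\<bar> \<le> 1\<close>: the heights
  \<open>h\<close> trace a free Motzkin path.

  By the two symmetries \<open>h\<close> is determined by its values at \<open>1, \<dots>, half\<close> with \<open>half = t div 2\<close>.
  The path that is assigned to a core has the heights \<open>0, h 1, \<dots>, h half, terminus\<close>. Reflection at column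
  \<open>0\<close> forces \<open>h 1 \<in> {- 1, 0}\<close>, so the path does not start with \<open>U\<close>. Reflection at column
  \<open>t / 2\<close> decides the end of the path, and this is where the parity matters.
  For \<open>s\<close> odd and \<open>d\<close> even, \<open>h half\<close> and \<open>h (half + 1)\<close> have fixed sum \<open>2 * terminus - 1\<close>, whence
  \<open>h half \<in> {terminus - 1, terminus}\<close>: the last step is not \<open>D\<close>. For \<open>s\<close> even
  the exceptions \<open>s / 2\<close> and \<open>(s + 2 * d) / 2\<close> lie in the two middle columns, and the
  relaxed condition is \<open>\<bar>h half - terminus\<bar> \<le> 1\<close>: the last step is arbitrary. For \<open>s\<close> and
  \<open>d\<close> odd, \<open>t\<close> is even, the middle column has \<open>h half = terminus\<close>, and in addition \<open>t / 2\<close> may be a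
  part. This part raises the height at \<open>half\<close> to \<open>terminus + 1\<close>, and it is possible exactly when
  the preceding height of the path is \<open>terminus\<close> (\<open>half_insertable_iff\<close>):
  the last step is \<open>F\<close>, or it is a \<open>D\<close> after a \<open>U\<close>.\<close>

section \<open>Strict partitions as symmetric sets of integers\<close>

text \<open>The value at \<open>0\<close> is a convention. Putting \<open>0\<close> outside makes closure under \<open>c\<close> exclude the part
  \<open>c\<close> itself.\<close>

definition maya :: "nat set \<Rightarrow> int set" where
  "maya X = {n. (0 < n \<and> nat n \<in> X) \<or> (n < 0 \<and> nat (- n) \<notin> X)}"

definition parts :: "int set \<Rightarrow> nat set" where
  "parts M = {x. 0 < x \<and> int x \<in> M}"

definition core_set :: "int \<Rightarrow> nat set \<Rightarrow> bool" where
  "core_set c X \<longleftrightarrow> (\<forall>n\<in>maya X. 2 * n \<noteq> c \<longrightarrow> n - c \<in> maya X)"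

lemma zero_not_maya [simp]: "0 \<notin> maya X"
  by (simp add: maya_def)

lemma maya_uminus_iff: "n \<noteq> 0 \<Longrightarrow> - n \<in> maya X \<longleftrightarrow> n \<notin> maya X"
  by (auto simp: maya_def)

lemma int_mem_maya: "0 < x \<Longrightarrow> int x \<in> maya X \<longleftrightarrow> x \<in> X"
  by (auto simp: maya_def)

lemma parts_maya: "0 \<notin> X \<Longrightarrow> parts (maya X) = X"
  by (auto simp: parts_def int_mem_maya) (metis gr0I int_mem_maya)+

lemma maya_parts:
  assumes "0 \<notin> M" and "\<And>n. n \<noteq> 0 \<Longrightarrow> - n \<in> M \<longleftrightarrow> n \<notin> M"
  shows "maya (parts M) = M"
proof -
  have "n \<in> maya (parts M) \<longleftrightarrow> n \<in> M" for n
  proof (cases n "0::int" rule: linorder_cases)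
    case less
    then show ?thesis using assms(2)[of n] by (auto simp: maya_def parts_def)
  qed (use assms(1) in \<open>auto simp: maya_def parts_def\<close>)
  then show ?thesis by blast
qed

text \<open>A move \<open>n \<mapsto> n - s\<close> with \<open>n > s\<close> shortens a part, one with \<open>n = s\<close> deletes it, one with
  \<open>0 < n < s\<close> concerns two parts of sum
  \<open>s\<close>, and one with \<open>n < 0\<close> is the mirror image of the first kind.\<close>

lemma core_set_iff_nat:
  assumes "0 \<notin> X" and "0 < s"
  shows "core_set (int s) X \<longleftrightarrow>
    s \<notin> X \<and> (\<forall>x\<in>X. s < x \<longrightarrow> x - s \<in> X) \<and> (\<forall>x\<in>X. x < s \<longrightarrow> 2 * x \<noteq> s \<longrightarrow> s - x \<notin> X)"
    (is "_ \<longleftrightarrow> ?R")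
proof
  assume c: "core_set (int s) X"
  have mem: "int x \<in> maya X" if "x \<in> X" for x
    using that assms(1) int_mem_maya[of x X] by (cases x) auto
  have step: "int x - int s \<in> maya X" if "x \<in> X" "2 * x \<noteq> s" for x
    using c mem[OF that(1)] that(2) unfolding core_set_def by fastforce
  show ?R
  proof (intro conjI ballI impI)
    show "s \<notin> X" using step[of s] assms(2) by auto
    show "x - s \<in> X" if "x \<in> X" "s < x" for x
      using step[of x] that int_mem_maya[of "x - s" X] by (auto simp: of_nat_diff)
    show "s - x \<notin> X" if "x \<in> X" "x < s" "2 * x \<noteq> s" for x
      using step[of x] that by (auto simp: maya_def nat_diff_distrib' simp flip: of_nat_diff)
  qed
next
  assume R: ?R
  show "core_set (int s) X"
    unfolding core_set_def
  proof (intro ballI impI)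
    fix n assume n: "n \<in> maya X" "2 * n \<noteq> int s"
    consider "n < 0" | "0 < n" "n < int s" | "n = int s" | "int s < n"
      using n(1) by (metis linorder_neqE_linordered_idom zero_not_maya)
    then show "n - int s \<in> maya X"
    proof cases
      case 1
      define y where "y = nat (- n)"
      have y: "n = - int y" "0 < y" using 1 by (auto simp: y_def)
      have "y \<notin> X" using n(1) y by (auto simp: maya_def)
      then have "y + s \<notin> X" using R y(2) by force
      then show ?thesis using y assms(2) by (auto simp: maya_def nat_add_distrib add.commute)
    next
      case 2
      define y where "y = nat n"
      have y: "n = int y" using 2 by (simp add: y_def)
      with n 2 have "y \<in> X" "y < s" "2 * y \<noteq> s" by (auto simp: maya_def)
      then have "s - y \<notin> X" using R by blast
      then show ?thesis using y \<open>y < s\<close> by (auto simp: maya_def nat_diff_distrib')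
    next
      case 3
      then show ?thesis using R n(1) by (auto simp: maya_def)
    next
      case 4
      define y where "y = nat n"
      have y: "n = int y" using 4 by (simp add: y_def)
      with n 4 have "y \<in> X" "s < y" by (auto simp: maya_def)
      then have "y - s \<in> X" using R by blast
      then show ?thesis using y \<open>s < y\<close> by (auto simp: maya_def nat_diff_distrib')
    qed
  qed
qed

lemma bar_core_iff_core_set:
  assumes "strict_partition l" and "0 < s"
  shows "bar_core s l \<longleftrightarrow> core_set (int s) (set l)"
proof -
  have pos: "0 \<notin> set l" and dec: "\<And>i j. i < j \<Longrightarrow> j < length l \<Longrightarrow> l ! j < l ! i"
    using assms(1) by (auto simp: strict_partition_def sorted_wrt_iff_nth_less)
  have sumlen: "(\<exists>i<length l. s \<in> {l ! i + l ! j | j. i < j \<and> j < length l})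
      \<longleftrightarrow> (\<exists>x\<in>set l. x < s \<and> 2 * x \<noteq> s \<and> s - x \<in> set l)" (is "?A \<longleftrightarrow> ?B")
  proof
    assume ?A
    then obtain i j where ij: "i < j" "j < length l" "s = l ! i + l ! j" by auto
    moreover have "l ! j < l ! i" "0 < l ! j"
      using ij dec pos by (auto intro!: gr0I simp: in_set_conv_nth)
    ultimately show ?B by (intro bexI[of _ "l ! i"]) auto
  next
    assume ?B
    then obtain x where x: "x \<in> set l" "x < s" "2 * x \<noteq> s" "s - x \<in> set l" by blast
    then obtain i j where ij: "i < length l" "j < length l" "l ! i = x" "l ! j = s - x"
      by (metis in_set_conv_nth)
    then have "i \<noteq> j" using x by auto
    then consider "i < j" | "j < i" by linarith
    then show ?A
    proof cases
      case 1
      then show ?thesis using ij x by (intro exI[of _ i]) (auto intro!: exI[of _ j])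
    next
      case 2
      then show ?thesis using ij x by (intro exI[of _ j]) (auto intro!: exI[of _ i])
    qed
  qed
  have difflen: "(\<exists>i<length l. s \<in> {1..l ! i} - {l ! i - l ! j | j. i < j \<and> j < length l})
      \<longleftrightarrow> (\<exists>x\<in>set l. s \<le> x \<and> x - s \<notin> set l)" (is "?A \<longleftrightarrow> ?B")
  proof
    assume ?A
    then obtain i where i: "i < length l" "s \<le> l ! i"
      and nd: "\<And>j. i < j \<Longrightarrow> j < length l \<Longrightarrow> s \<noteq> l ! i - l ! j" by auto
    have "l ! i - s \<notin> set l"
    proof
      assume "l ! i - s \<in> set l"
      then obtain j where j: "j < length l" "l ! j = l ! i - s" by (metis in_set_conv_nth)
      then have "l ! j < l ! i" using i assms(2) by auto
      then have "i < j" using dec[of j i] i j by (metis less_asym' linorder_neqE_nat)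
      then show False using nd[of j] j i by auto
    qed
    then show ?B using i by (intro bexI[of _ "l ! i"]) auto
  next
    assume ?B
    then obtain i where i: "i < length l" "s \<le> l ! i" "l ! i - s \<notin> set l"
      by (metis in_set_conv_nth)
    have "s \<noteq> l ! i - l ! j" if "i < j" "j < length l" for j
    proof
      assume "s = l ! i - l ! j"
      then have "l ! i - s = l ! j" using dec[OF that] by simp
      then show False using i that by auto
    qed
    then show ?A using i assms(2) by (intro exI[of _ i]) auto
  qed
  have "bar_core s l \<longleftrightarrow> \<not> (\<exists>x\<in>set l. x < s \<and> 2 * x \<noteq> s \<and> s - x \<in> set l)
     \<and> \<not> (\<exists>x\<in>set l. s \<le> x \<and> x - s \<notin> set l)"
    unfolding sumlen[symmetric] difflen[symmetric] bar_core_def bar_lengths_def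
    using assms(1) by blast
  also have "\<dots> \<longleftrightarrow> core_set (int s) (set l)"
    unfolding core_set_iff_nat[OF pos assms(2)] using pos by (auto simp: le_less)
  finally show ?thesis .
qed

lemma bij_betw_set_strict_partitions:
  "bij_betw set {l. strict_partition l} {X. finite X \<and> (0::nat) \<notin> X}"
proof (rule bij_betw_byWitness[where f' = "\<lambda>X. rev (sorted_list_of_set X)"])
  show "\<forall>l\<in>{l. strict_partition l}. rev (sorted_list_of_set (set l)) = l"
  proof
    fix l assume "l \<in> {l. strict_partition l}"
    then have "sorted_wrt (<) (rev l)" by (simp add: strict_partition_def sorted_wrt_rev)
    then have "sorted_list_of_set (set (rev l)) = rev l"
      by (intro strict_sorted_equal) auto
    then show "rev (sorted_list_of_set (set l)) = l" by simp
  qed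
qed (auto simp: strict_partition_def sorted_wrt_rev intro!: gr0I)

lemma bij_betw_set_BC:
  assumes "0 < s1" "0 < s2" "0 < s3"
  shows "bij_betw set (BC s1 s2 s3)
    {X. finite X \<and> 0 \<notin> X \<and> core_set (int s1) X \<and> core_set (int s2) X \<and> core_set (int s3) X}"
proof (rule bij_betw_subset[OF bij_betw_set_strict_partitions])
  show "BC s1 s2 s3 \<subseteq> {l. strict_partition l}" by (auto simp: BC_def bar_core_def)
  have BC: "BC s1 s2 s3 = {l. strict_partition l \<and> core_set (int s1) (set l)
      \<and> core_set (int s2) (set l) \<and> core_set (int s3) (set l)}"
    using bar_core_iff_core_set assms by (auto simp: BC_def bar_core_def)
  show "set ` BC s1 s2 s3 = {X. finite X \<and> 0 \<notin> X \<and> core_set (int s1) X \<and> core_set (int s2) X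
      \<and> core_set (int s3) X}" (is "_ = ?S")
  proof
    show "set ` BC s1 s2 s3 \<subseteq> ?S"
      unfolding BC by (auto simp: strict_partition_def)
    show "?S \<subseteq> set ` BC s1 s2 s3"
    proof
      fix X assume X: "X \<in> ?S"
      then have "X \<in> set ` {l. strict_partition l}"
        using bij_betw_imp_surj_on[OF bij_betw_set_strict_partitions] by auto
      then show "X \<in> set ` BC s1 s2 s3" unfolding BC using X by auto
    qed
  qed
qed

lemma maya_insert: "0 < x \<Longrightarrow> maya (insert x X) = insert (int x) (maya X - {- int x})"
  by (auto simp: maya_def)

lemma maya_remove: "0 < x \<Longrightarrow> maya (X - {x}) = insert (- int x) (maya X - {int x})"
  by (auto simp: maya_def)

text \<open>Inserting \<open>x\<close> exchanges \<open>- x\<close> for \<open>x\<close> in the encoding. Closure could only fail at \<open>x\<close>, or at the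
  integer \<open>c - x\<close>, which used to move to \<open>- x\<close>; these two conditions mirror each other.\<close>

lemma core_set_insert:
  assumes "core_set c X" and "x \<notin> X" and "0 < x" and "2 * int x = c \<or> int x - c \<in> maya X"
  shows "core_set c (insert x X)"
proof -
  have x: "int x \<notin> maya X" using assms(2,3) int_mem_maya by simp
  have refl: "c - int x \<notin> maya X"
    using assms(4)
  proof
    assume "2 * int x = c"
    then show ?thesis using x by (metis add_diff_cancel_right' mult_2)
  next
    assume *: "int x - c \<in> maya X"
    then have "int x - c \<noteq> 0" by (metis zero_not_maya)
    then show ?thesis using maya_uminus_iff[of "int x - c" X] * by simp
  qed
  show ?thesis
    unfolding core_set_def maya_insert[OF assms(3)]
  proof (intro ballI impI)
    fix n assume n: "n \<in> insert (int x) (maya X - {- int x})" "2 * n \<noteq> c"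
    show "n - c \<in> insert (int x) (maya X - {- int x})"
    proof (cases "n = int x")
      case True
      then show ?thesis using n(2) assms(4) by auto
    next
      case False
      then have "n \<in> maya X" "n - c \<in> maya X" using n assms(1) by (auto simp: core_set_def)
      moreover from this refl have "n - c \<noteq> - int x" by (metis add.commute add_diff_cancel_left' diff_add_cancel diff_conv_add_uminus)
      ultimately show ?thesis by simp
    qed
  qed
qed

lemma core_set_remove:
  assumes "core_set c X" and "0 < x" and "0 < c" and "int x + c \<notin> maya X"
  shows "core_set c (X - {x})"
  unfolding core_set_def maya_remove[OF assms(2)]
proof (intro ballI impI)
  fix n assume n: "n \<in> insert (- int x) (maya X - {int x})" "2 * n \<noteq> c"
  show "n - c \<in> insert (- int x) (maya X - {int x})"
  proof (cases "n = - int x")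
    case True
    then show ?thesis using maya_uminus_iff[of "int x + c" X] assms by simp
  next
    case False
    then have "n \<in> maya X" "n - c \<in> maya X" using n assms(1) by (auto simp: core_set_def)
    moreover from this assms(4) have "n - c \<noteq> int x" by (metis diff_add_cancel)
    ultimately show ?thesis by simp
  qed
qed

section \<open>Paths as height functions\<close>

definition height :: "step list \<Rightarrow> nat \<Rightarrow> int" where
  "height p j = sum_list (map (snd \<circ> step_vec) (take j p))"

definition step_of_rise :: "int \<Rightarrow> step" where
  "step_of_rise r = (if r = 1 then U else if r = 0 then F else D)"

lemma height_0 [simp]: "height p 0 = 0"
  by (simp add: height_def)

lemma height_Suc: "j < length p \<Longrightarrow> height p (Suc j) = height p j + snd (step_vec (p ! j))"
  by (simp add: height_def take_Suc_conv_app_nth)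

lemma height_beyond: "length p \<le> j \<Longrightarrow> height p j = height p (length p)"
  by (simp add: height_def)

lemma step_of_rise_snd [simp]: "step_of_rise (snd (step_vec x)) = x"
  by (cases x) (auto simp: step_of_rise_def)

lemma nth_eq_step_of_rise:
  "j < length p \<Longrightarrow> p ! j = step_of_rise (height p (Suc j) - height p j)"
  by (simp add: height_Suc)

lemma height_of_rises:
  assumes "g 0 = 0" and "\<And>j. j < L \<Longrightarrow> \<bar>g (Suc j) - g j\<bar> \<le> 1" and "j \<le> L"
  shows "height (map (\<lambda>i. step_of_rise (g (Suc i) - g i)) [0..<L]) j = g j"
  using assms(3)
proof (induction j)
  case (Suc j)
  have "snd (step_vec (step_of_rise r)) = r" if "\<bar>r\<bar> \<le> 1" for r
    using that by (auto simp: step_of_rise_def abs_le_iff)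
  then show ?case using Suc assms(2)[of j] by (simp add: height_Suc)
qed (simp add: assms(1))

definition profile :: "nat \<Rightarrow> int \<Rightarrow> (nat \<Rightarrow> int) \<Rightarrow> bool" where
  "profile L e g \<longleftrightarrow> g 0 = 0 \<and> (\<forall>j<L. \<bar>g (Suc j) - g j\<bar> \<le> 1) \<and> (\<forall>j\<ge>L. g j = e)"

lemma sum_step_vec: "sum_list (map step_vec p) = (int (length p), height p (length p))"
proof -
  have "sum_list (map step_vec p) = (int (length p), sum_list (map (snd \<circ> step_vec) p))"
  proof (induction p)
    case (Cons a p)
    then show ?case by (cases a) auto
  qed (simp add: zero_prod_def)
  then show ?thesis by (simp add: height_def)
qed

lemma free_motzkin_path_iff:
  "free_motzkin_path (int L) e p \<longleftrightarrow> length p = L \<and> profile L e (height p)"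
proof
  assume free: "free_motzkin_path (int L) e p"
  then have len: "length p = L" and e: "height p L = e"
    by (auto simp: free_motzkin_path_def sum_step_vec)
  have "\<bar>snd (step_vec x)\<bar> \<le> 1" for x by (cases x) auto
  then have "\<bar>height p (Suc j) - height p j\<bar> \<le> 1" if "j < L" for j
    using that len by (simp add: height_Suc)
  moreover have "height p j = e" if "L \<le> j" for j
    using that height_beyond[of p j] len e by simp
  ultimately show "length p = L \<and> profile L e (height p)"
    using len by (simp add: profile_def)
qed (auto simp: free_motzkin_path_def sum_step_vec profile_def)

text \<open>A path is recovered from its heights, and every sequence with increments in \<open>{- 1, 0, 1}\<close> occurs.\<close>

lemma bij_betw_height:
  "bij_betw height {p. free_motzkin_path (int L) e p} {g. profile L e g}"
proof -
  have "inj_on height {p. free_motzkin_path (int L) e p}"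
    by (auto simp: inj_on_def free_motzkin_path_iff nth_eq_step_of_rise intro!: nth_equalityI)
  moreover have "g \<in> height ` {p. free_motzkin_path (int L) e p}" if g: "profile L e g" for g
  proof -
    define p where "p = map (\<lambda>i. step_of_rise (g (Suc i) - g i)) [0..<L]"
    have len: "length p = L" by (simp add: p_def)
    have le: "height p j = g j" if "j \<le> L" for j
      unfolding p_def using g that by (intro height_of_rises) (auto simp: profile_def)
    have "height p = g"
    proof
      fix j
      show "height p j = g j"
        using le[of j] le[of L] height_beyond[of p j] g len
        by (cases "j \<le> L") (auto simp: profile_def)
    qed
    then show ?thesis using g len by (intro image_eqI[of _ _ p]) (auto simp: free_motzkin_path_iff)
  qed
  ultimately show ?thesis
    by (auto simp: bij_betw_def free_motzkin_path_iff)
qed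

lemma prefix_single_iff: "prefix [a] p \<longleftrightarrow> p \<noteq> [] \<and> p ! 0 = a"
  by (cases p) auto

lemma suffix_single_iff: "suffix [a] p \<longleftrightarrow> p \<noteq> [] \<and> p ! (length p - 1) = a"
  by (cases p rule: rev_cases) (auto simp: suffix_def)

lemma suffix_pair_iff:
  "suffix [a, b] p \<longleftrightarrow> 2 \<le> length p \<and> p ! (length p - 2) = a \<and> p ! (length p - 1) = b"
proof (cases p rule: rev_cases)
  case (snoc q y)
  then show ?thesis
    by (cases q rule: rev_cases) (auto simp: suffix_def nth_append)
qed (auto simp: suffix_def)

section \<open>Charges: cores in column coordinates\<close>

text \<open>The parameter \<open>t\<close> is the middle bar length \<open>s + d\<close>; the condition \<open>d < t\<close> is \<open>s > 0\<close>.\<close>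

locale abacus =
  fixes t d :: int
  assumes d_pos: "0 < d" and d_less_t: "d < t" and coprime_dt: "coprime d t"
begin

lemma t_gt_1: "1 < t"
  using d_pos d_less_t by simp

text \<open>The value \<open>h 0 = - 1\<close> expresses that no multiple of \<open>t\<close> is a part. The reflection rule fails
  in this column, because \<open>0\<close> is its own mirror image, and is imposed on the other columns only.\<close>

definition charge :: "(int \<Rightarrow> int) \<Rightarrow> bool" where
  "charge h \<longleftrightarrow> (\<forall>j. h (j + t) = h j - d) \<and> h 0 = -1 \<and> (\<forall>j. \<not> t dvd j \<longrightarrow> h (- j) = - 1 - h j)"

definition beads :: "(int \<Rightarrow> int) \<Rightarrow> int set" where
  "beads h = {d * j + t * l | j l. l \<le> h j}"

lemma charge_shift: "charge h \<Longrightarrow> h (j + t) = h j - d"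
  by (simp add: charge_def)

lemma charge_uminus: "charge h \<Longrightarrow> \<not> t dvd j \<Longrightarrow> h (- j) = - 1 - h j"
  by (simp add: charge_def)

lemma charge_0: "charge h \<Longrightarrow> h 0 = - 1"
  by (simp add: charge_def)

lemma charge_shift_mult:
  assumes "charge h"
  shows "h (j + t * q) = h j - d * q"
proof (induction q rule: int_induct[where k = 0])
  case (step1 i)
  then show ?case using charge_shift[OF assms, of "j + t * i"] by (simp add: algebra_simps)
next
  case (step2 i)
  then show ?case using charge_shift[OF assms, of "j + t * (i - 1)"] by (simp add: algebra_simps)
qed simp

lemma coordinates:
  obtains j l where "n = d * j + t * l"
proof -
  obtain u v where "u * d + v * t = 1"
    using bezout_int[of d t] coprime_dt by auto
  then have "n = d * (n * u) + t * (n * v)" by (metis mult.commute mult.left_commute mult_1_right ring_class.ring_distribs(1))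
  then show ?thesis by (rule that)
qed

lemma t_dvd_mult_iff: "t dvd d * m \<longleftrightarrow> t dvd m"
  using coprime_dt by (simp add: coprime_commute coprime_dvd_mult_right_iff)

text \<open>The coordinates of an integer are unique up to \<open>(j, l) \<mapsto> (j + t * q, l - d * q)\<close>, and the rule
  \<open>h (j + t) = h j - d\<close> makes the condition \<open>l \<le> h j\<close> independent of this choice.\<close>

lemma mem_beads_iff:
  assumes "charge h"
  shows "d * j + t * l \<in> beads h \<longleftrightarrow> l \<le> h j"
proof
  assume "d * j + t * l \<in> beads h"
  then obtain j' l' where eq: "d * j + t * l = d * j' + t * l'" and le: "l' \<le> h j'"
    unfolding beads_def by blast
  then have "d * (j - j') = t * (l' - l)" by (simp add: algebra_simps)
  then have "t dvd j - j'" by (metis dvd_triv_left t_dvd_mult_iff)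
  then obtain q where q: "j = j' + t * q" by (metis add.commute diff_add_cancel dvdE)
  with eq have "t * (l + d * q) = t * l'" by (simp add: algebra_simps)
  then have "l' = l + d * q" using t_gt_1 by simp
  then show "l \<le> h j" using le charge_shift_mult[OF assms, of j' q] q by simp
qed (auto simp: beads_def)

lemma charge_multiple: "charge h \<Longrightarrow> h (t * q) = - 1 - d * q"
  using charge_shift_mult[of h 0 q] charge_0[of h] by simp

lemma maya_beads:
  assumes "charge h"
  shows "maya (parts (beads h)) = beads h"
proof (rule maya_parts)
  show "0 \<notin> beads h" using mem_beads_iff[OF assms, of 0 0] charge_0[OF assms] by simp
  fix n :: int assume n: "n \<noteq> 0"
  obtain j l where jl: "n = d * j + t * l" by (rule coordinates)
  then have "- n = d * (- j) + t * (- l)" by simp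
  then have iff: "- n \<in> beads h \<longleftrightarrow> - l \<le> h (- j)" using mem_beads_iff[OF assms] by metis
  have iff': "n \<in> beads h \<longleftrightarrow> l \<le> h j" using mem_beads_iff[OF assms] jl by simp
  show "- n \<in> beads h \<longleftrightarrow> n \<notin> beads h"
  proof (cases "t dvd j")
    case False
    then show ?thesis using charge_uminus[OF assms] iff iff' by auto
  next
    case True
    then obtain q where q: "j = t * q" by blast
    have "h j = - 1 - d * q" "h (- j) = - 1 + d * q"
      using charge_multiple[OF assms, of q] charge_multiple[OF assms, of "- q"] q by auto
    moreover have "n = t * (l + d * q)" using jl q by (simp add: algebra_simps)
    then have "l + d * q \<noteq> 0" using n by auto
    ultimately show ?thesis using iff iff' by auto
  qed
qed

lemma zero_not_parts [simp]: "0 \<notin> parts M"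
  by (simp add: parts_def)

lemma finite_parts_beads:
  assumes "charge h"
  shows "finite (parts (beads h))"
proof -
  \<comment> \<open>Up to shifts of the coordinates, \<open>d * r + t * h r\<close> is the largest element of column \<open>r\<close>.\<close>
  define N where "N = (\<Sum>r\<in>{0..<t}. \<bar>d * r + t * h r\<bar>)"
  have "int x \<le> N" if "x \<in> parts (beads h)" for x
  proof -
    have "int x \<in> beads h" using that by (simp add: parts_def)
    then obtain j l where jl: "int x = d * j + t * l" "l \<le> h j" by (auto simp: beads_def)
    define r q where "r = j mod t" and "q = j div t"
    have j: "j = r + t * q" and r: "r \<in> {0..<t}" using t_gt_1 by (auto simp: r_def q_def)
    have "l + d * q \<le> h r" using jl(2) charge_shift_mult[OF assms, of r q] j by simp
    then have "t * (l + d * q) \<le> t * h r" using t_gt_1 by simp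
    moreover have "int x = d * r + t * (l + d * q)" using jl j by (simp add: algebra_simps)
    moreover have "\<bar>d * r + t * h r\<bar> \<le> N" unfolding N_def using r by (intro member_le_sum) auto
    ultimately show ?thesis by linarith
  qed
  then have "parts (beads h) \<subseteq> {..nat N}" by force
  then show ?thesis using finite_subset by blast
qed

lemma downset_int_eq_atMost:
  fixes A :: "int set"
  assumes "a \<in> A" and "\<And>l. l \<in> A \<Longrightarrow> l \<le> b" and down: "\<And>l. l \<in> A \<Longrightarrow> l - 1 \<in> A"
  shows "\<exists>k. \<forall>l. l \<in> A \<longleftrightarrow> l \<le> k"
proof -
  define k where "k = Max (A \<inter> {a..b})"
  have fin: "finite (A \<inter> {a..b})" by simp
  have a: "a \<in> A \<inter> {a..b}" using assms by auto
  then have k: "k \<in> A" using Max_in[OF fin] unfolding k_def by blast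
  have "l \<le> k" if "l \<in> A" for l
  proof (cases "a \<le> l")
    case True
    then show ?thesis unfolding k_def using that assms(2) fin by (intro Max_ge) auto
  next
    case False
    then show ?thesis using Max_ge[OF fin a] k_def by simp
  qed
  moreover have "l \<in> A" if "l \<le> k" for l
    using that by (induction l rule: int_le_induct) (auto intro: k down)
  ultimately show ?thesis by blast
qed

text \<open>Finiteness of \<open>X\<close> bounds every column from above and puts all very negative integers into the
  encoding; together with closure under \<open>t\<close> this makes every column a set \<open>{.. h j}\<close>. The rules for
  \<open>h\<close> are then read off from the two ways to name an integer and from antisymmetry.\<close>

lemma exists_charge:
  assumes "finite X" and "0 \<notin> X" and closed: "\<And>n. n \<in> maya X \<Longrightarrow> n - t \<in> maya X"
  shows "\<exists>h. charge h \<and> X = parts (beads h)"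
proof -
  obtain N where N: "\<And>x. x \<in> X \<Longrightarrow> x \<le> N"
    using assms(1) by (metis finite_nat_set_iff_bounded_le)
  have big: "n \<notin> maya X" if "int N < n" for n
    using that N[of "nat n"] by (auto simp: maya_def)
  have small: "n \<in> maya X" if "n < - int N" for n
    using that N[of "nat (- n)"] by (auto simp: maya_def)
  have "\<exists>k. \<forall>l. l \<in> {l. d * j + t * l \<in> maya X} \<longleftrightarrow> l \<le> k" for j
  proof (rule downset_int_eq_atMost)
    \<comment> \<open>Levels beyond \<open>b\<close> in either direction outweigh the column offset \<open>d * j\<close> and the bound \<open>N\<close>.\<close>
    define b where "b = \<bar>d * j\<bar> + int N + 1"
    have b: "b \<le> t * b" using t_gt_1 unfolding b_def by simp
    show "- b \<in> {l. d * j + t * l \<in> maya X}"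
    proof -
      have "d * j + t * (- b) \<le> d * j - b" using b by simp
      also have "\<dots> < - int N" unfolding b_def by linarith
      finally have "d * j + t * (- b) < - int N" .
      then show ?thesis using small by blast
    qed
    show "l \<le> b" if "l \<in> {l. d * j + t * l \<in> maya X}" for l
    proof (rule ccontr)
      assume "\<not> l \<le> b"
      then have "b < l" by simp
      then have "0 < l" unfolding b_def by linarith
      then have "l \<le> t * l" using t_gt_1 by simp
      with \<open>b < l\<close> have "int N < d * j + t * l" unfolding b_def by linarith
      then show False using big that by blast
    qed
    show "l - 1 \<in> {l. d * j + t * l \<in> maya X}" if "l \<in> {l. d * j + t * l \<in> maya X}" for l
      using closed[of "d * j + t * l"] that by (simp add: algebra_simps)
  qed
  then obtain h where h: "\<And>j l. d * j + t * l \<in> maya X \<longleftrightarrow> l \<le> h j"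
    by (simp only: mem_Collect_eq) metis
  have "charge h"
    unfolding charge_def
  proof (intro conjI allI impI)
    show "h (j + t) = h j - d" for j
    proof -
      have "l \<le> h (j + t) \<longleftrightarrow> l \<le> h j - d" for l
        using h[of "j + t" l] h[of j "l + d"] by (simp add: algebra_simps)
      then show ?thesis by (meson order.antisym order.refl)
    qed
    have "t \<notin> maya X" using closed[of t] by auto
    then have "- t \<in> maya X" using maya_uminus_iff[of t X] t_gt_1 by simp
    then show "h 0 = - 1" using h[of 0 "- 1"] h[of 0 0] by simp
    show "h (- j) = - 1 - h j" if "\<not> t dvd j" for j
    proof -
      have "- l \<le> h (- j) \<longleftrightarrow> \<not> l \<le> h j" for l
      proof -
        have "d * j + t * l \<noteq> 0"
          using that t_dvd_mult_iff[of j] by (metis add_eq_0_iff2 dvd_minus_iff dvd_triv_left)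
        then show ?thesis
          using maya_uminus_iff[of "d * j + t * l" X] h[of j l] h[of "- j" "- l"] by simp
      qed
      from this[of "h j"] this[of "h j + 1"] show ?thesis by simp
    qed
  qed
  moreover have "beads h = maya X"
  proof -
    have "n \<in> beads h \<longleftrightarrow> n \<in> maya X" for n
      by (rule coordinates[of n]) (use h mem_beads_iff[OF \<open>charge h\<close>] in auto)
    then show ?thesis by blast
  qed
  ultimately show ?thesis using parts_maya[OF assms(2)] by auto
qed

lemma core_set_beads:
  assumes "charge h"
  shows "core_set (t * a + d * b) (parts (beads h)) \<longleftrightarrow>
    (\<forall>j l. l \<le> h j \<longrightarrow> 2 * (d * j + t * l) \<noteq> t * a + d * b \<longrightarrow> l - a \<le> h (j - b))"
proof -
  have "d * j + t * l - (t * a + d * b) \<in> beads h \<longleftrightarrow> l - a \<le> h (j - b)" for j l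
    using mem_beads_iff[OF assms, of "j - b" "l - a"] by (simp add: algebra_simps)
  then show ?thesis
    unfolding core_set_def maya_beads[OF assms] by (fastforce simp: beads_def)
qed

text \<open>The condition that a Motzkin path imposes on two consecutive heights.\<close>

definition gentle :: "(int \<Rightarrow> int) \<Rightarrow> int \<Rightarrow> bool" where
  "gentle h j \<longleftrightarrow> \<bar>h (j + 1) - h j\<bar> \<le> 1"

text \<open>Both closure conditions compare adjacent columns, so they are grouped by the pair \<open>(j, j + 1)\<close>:
  \<open>t - d\<close> moves from \<open>j\<close> to \<open>j + 1\<close>, and \<open>t + d\<close> moves back.\<close>

lemma core_pair_iff_edges:
  assumes "charge h"
  shows "core_set (t - d) (parts (beads h)) \<and> core_set (t + d) (parts (beads h)) \<longleftrightarrow>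
    (\<forall>j. (\<forall>l \<le> h j. 2 * (d * j + t * l) \<noteq> t - d \<longrightarrow> l - 1 \<le> h (j + 1)) \<and>
         (\<forall>l \<le> h (j + 1). 2 * (d * (j + 1) + t * l) \<noteq> t + d \<longrightarrow> l - 1 \<le> h j))"
    (is "?A \<and> ?B \<longleftrightarrow> (\<forall>j. ?P j \<and> ?Q j)")
proof -
  have "?A \<longleftrightarrow> (\<forall>j. ?P j)"
    using core_set_beads[OF assms, of 1 "- 1"] by auto
  moreover have "?B \<longleftrightarrow> (\<forall>j. \<forall>l \<le> h j. 2 * (d * j + t * l) \<noteq> t + d \<longrightarrow> l - 1 \<le> h (j - 1))"
    using core_set_beads[OF assms, of 1 1] by auto
  moreover have "\<dots> \<longleftrightarrow> (\<forall>j. ?Q j)"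
    by (metis add_diff_cancel_right' diff_add_cancel)
  ultimately show ?thesis by blast
qed

lemma edge_iff_gentle:
  assumes "\<And>l. 2 * (d * j + t * l) \<noteq> t - d" "\<And>l. 2 * (d * (j + 1) + t * l) \<noteq> t + d"
  shows "(\<forall>l \<le> h j. 2 * (d * j + t * l) \<noteq> t - d \<longrightarrow> l - 1 \<le> h (j + 1)) \<and>
         (\<forall>l \<le> h (j + 1). 2 * (d * (j + 1) + t * l) \<noteq> t + d \<longrightarrow> l - 1 \<le> h j) \<longleftrightarrow> gentle h j"
  using assms by (force simp: gentle_def)

lemma core_pair_iff_gentle:
  assumes "charge h" and "odd (t - d)"
  shows "core_set (t - d) (parts (beads h)) \<and> core_set (t + d) (parts (beads h)) \<longleftrightarrow> (\<forall>j. gentle h j)"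
proof -
  have "2 * m \<noteq> t - d" "2 * m \<noteq> t + d" for m
    using assms(2) by (metis dvd_triv_left, metis dvd_triv_left even_add even_diff)
  then show ?thesis
    unfolding core_pair_iff_edges[OF assms(1)] by (intro iff_allI edge_iff_gentle)
qed

lemma gentle_shift_mult:
  assumes "charge h"
  shows "gentle h (j + t * q) \<longleftrightarrow> gentle h j"
proof -
  have "h (j + t * q + 1) = h (j + 1) - d * q"
    using charge_shift_mult[OF assms, of "j + 1" q] by (simp add: ac_simps)
  then show ?thesis using charge_shift_mult[OF assms, of j q] by (simp add: gentle_def)
qed

lemma gentle_reflect:
  assumes "charge h" and "\<not> t dvd j" and "\<not> t dvd j + 1"
  shows "gentle h (- j - 1) \<longleftrightarrow> gentle h j"
proof -
  have "h (- j - 1) = - 1 - h (j + 1)" using charge_uminus[OF assms(1,3)] by simp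
  then show ?thesis using charge_uminus[OF assms(1,2)] by (auto simp: gentle_def abs_le_iff)
qed

lemma not_t_dvd: "0 < j \<Longrightarrow> j < t \<Longrightarrow> \<not> t dvd j"
  using zdvd_not_zless by blast

lemma gentle_0_iff:
  assumes "charge h"
  shows "gentle h 0 \<and> gentle h (- 1) \<longleftrightarrow> h 1 = - 1 \<or> h 1 = 0"
  using charge_0[OF assms] charge_uminus[OF assms not_t_dvd[of 1]] t_gt_1
  by (auto simp: gentle_def)

text \<open>The shift by \<open>t\<close> and the reflection \<open>j \<mapsto> - j - 1\<close> act on the pairs of adjacent columns. The pairs
  starting at \<open>0, \<dots>, (t - 2) div 2\<close> represent all orbits, except that for odd \<open>t\<close> the middle pair is fixed
  up to a shift; it is the one with \<open>t dvd 2 * j + 1\<close> and is left aside here. Column \<open>0\<close> violates the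
  reflection rule, so both of its pairs are needed, and together they say \<open>h 1 \<in> {- 1, 0}\<close>.\<close>

lemma all_gentle_iff:
  assumes "charge h"
  shows "(\<forall>j. \<not> t dvd 2 * j + 1 \<longrightarrow> gentle h j) \<longleftrightarrow>
    (h 1 = - 1 \<or> h 1 = 0) \<and> (\<forall>j. 1 \<le> j \<longrightarrow> 2 * j + 2 \<le> t \<longrightarrow> gentle h j)" (is "?L \<longleftrightarrow> ?R")
proof
  assume L: ?L
  have "\<not> t dvd 1" using t_gt_1 by auto
  then have "gentle h 0" "gentle h (- 1)" using L by auto
  moreover have "gentle h j" if "1 \<le> j" "2 * j + 2 \<le> t" for j
    using L not_t_dvd[of "2 * j + 1"] that by auto
  ultimately show ?R using gentle_0_iff[OF assms] by blast
next
  assume R: ?R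
  then have ends: "gentle h 0" "gentle h (- 1)" using gentle_0_iff[OF assms] by blast+
  show ?L
  proof (intro allI impI)
    fix j assume nd: "\<not> t dvd 2 * j + 1"
    define r q where "r = j mod t" and "q = j div t"
    have j: "j = r + t * q" and r: "0 \<le> r" "r < t" using t_gt_1 by (auto simp: r_def q_def)
    have "2 * r + 1 \<noteq> t"
    proof
      assume "2 * r + 1 = t"
      then have "2 * j + 1 = t * (1 + 2 * q)" using j by (simp add: algebra_simps)
      then show False using nd by simp
    qed
    then consider "r = 0" | "1 \<le> r" "2 * r + 2 \<le> t" | "r = t - 1" | "t \<le> 2 * r" "r \<le> t - 2"
      using r by linarith
    then have "gentle h r"
    proof cases
      case 3
      then show ?thesis using gentle_shift_mult[OF assms, of "- 1" 1] ends by simp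
    next
      case 4
      \<comment> \<open>The pair at \<open>r\<close> is the pair at \<open>- i - 1\<close>, shifted by \<open>t\<close>.\<close>
      define i where "i = t - 1 - r"
      have "gentle h i" using R 4 by (auto simp: i_def)
      then have "gentle h (- i - 1)"
        using gentle_reflect[OF assms, of i] not_t_dvd[of i] not_t_dvd[of "i + 1"] 4 r t_gt_1
        by (auto simp: i_def)
      then show ?thesis using gentle_shift_mult[OF assms, of "- i - 1" 1] by (simp add: i_def)
    qed (use ends R in auto)
    then show "gentle h j" using gentle_shift_mult[OF assms] j by simp
  qed
qed

lemma charge_middle:
  assumes "charge h" and "t = 2 * k + 1"
  shows "h (k + 1) = - 1 - d - h k"
proof -
  have "\<not> t dvd k" using not_t_dvd[of k] assms(2) t_gt_1 by auto
  then have "h (- k) = - 1 - h k" by (rule charge_uminus[OF assms(1)])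
  moreover have "h (k + 1) = h (- k) - d"
    using charge_shift[OF assms(1), of "- k"] assms(2) by (simp add: algebra_simps)
  ultimately show ?thesis by simp
qed

lemma t_dvd_odd_iff:
  assumes "t = 2 * k + 1"
  shows "t dvd 2 * j + 1 \<longleftrightarrow> (\<exists>q. j = k + t * q)"
proof
  assume "t dvd 2 * j + 1"
  then obtain m where m: "2 * j + 1 = t * m" by blast
  then have "odd (t * m)" by (metis odd_two_times_div_two_succ dvd_triv_left even_plus_one_iff)
  then obtain q where "m = 2 * q + 1" by (metis even_mult_iff oddE)
  then have "j = k + t * q" using m assms by (simp add: algebra_simps)
  then show "\<exists>q. j = k + t * q" ..
next
  assume "\<exists>q. j = k + t * q"
  then obtain q where "j = k + t * q" ..
  moreover have "t * (1 + 2 * q) = t + 2 * (t * q)" by (simp add: algebra_simps)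
  ultimately have "2 * j + 1 = t * (1 + 2 * q)" using assms by linarith
  then show "t dvd 2 * j + 1" by simp
qed

text \<open>In the middle pair the heights \<open>h k\<close> and \<open>h (k + 1) = 2 * e - 1 - h k\<close> have an odd difference, which has
  to be \<open>1\<close> or \<open>- 1\<close>.\<close>

lemma all_gentle_odd_iff:
  assumes "charge h" and "t = 2 * k + 1" and "d = - 2 * e"
  shows "(\<forall>j. gentle h j) \<longleftrightarrow>
    (\<forall>j. \<not> t dvd 2 * j + 1 \<longrightarrow> gentle h j) \<and> (h k = e \<or> h k = e - 1)"
proof -
  have "gentle h k \<longleftrightarrow> h k = e \<or> h k = e - 1"
    using charge_middle[OF assms(1,2)] assms(3) by (auto simp: gentle_def)
  moreover have "gentle h j \<longleftrightarrow> gentle h k" if "t dvd 2 * j + 1" for j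
    using that t_dvd_odd_iff[OF assms(2)] gentle_shift_mult[OF assms(1)] by auto
  ultimately show ?thesis
    using t_dvd_odd_iff[OF assms(2), of k] by (metis add.right_neutral mult_zero_right)
qed

text \<open>Here \<open>t - d\<close> and \<open>t + d\<close> are even, and their halves are the integers that are exempt from
  closure. They lie in the two middle columns, both at level \<open>e + 1\<close>. With
  \<open>h k = e + u\<close> and \<open>h (k + 1) = e - u\<close>, the exemption of this level allows the heights to differ by
  \<open>2\<close> as well, which gives \<open>\<bar>u\<bar> \<le> 1\<close>.\<close>

lemma core_pair_iff_gentle_exceptional:
  assumes "charge h" and k: "t = 2 * k + 1" and e: "d = - 2 * e - 1"
  shows "core_set (t - d) (parts (beads h)) \<and> core_set (t + d) (parts (beads h)) \<longleftrightarrow>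
    (\<forall>j. \<not> t dvd 2 * j + 1 \<longrightarrow> gentle h j) \<and> \<bar>h k - e\<bar> \<le> 1" (is "_ \<longleftrightarrow> ?R")
proof -
  let ?E = "\<lambda>j. (\<forall>l \<le> h j. 2 * (d * j + t * l) \<noteq> t - d \<longrightarrow> l - 1 \<le> h (j + 1)) \<and>
         (\<forall>l \<le> h (j + 1). 2 * (d * (j + 1) + t * l) \<noteq> t + d \<longrightarrow> l - 1 \<le> h j)"
  have regular: "?E j \<longleftrightarrow> gentle h j" if "\<not> t dvd 2 * j + 1" for j
  proof (rule edge_iff_gentle)
    fix l
    show "2 * (d * j + t * l) \<noteq> t - d"
    proof
      assume "2 * (d * j + t * l) = t - d"
      then have "d * (2 * j + 1) = t * (1 - 2 * l)" by (simp add: algebra_simps)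
      then show False using that t_dvd_mult_iff[of "2 * j + 1"] by simp
    qed
    show "2 * (d * (j + 1) + t * l) \<noteq> t + d"
    proof
      assume "2 * (d * (j + 1) + t * l) = t + d"
      then have "d * (2 * j + 1) = t * (1 - 2 * l)" by (simp add: algebra_simps)
      then show False using that t_dvd_mult_iff[of "2 * j + 1"] by simp
    qed
  qed
  have middle: "?E j \<longleftrightarrow> \<bar>h k - e\<bar> \<le> 1" if j: "j = k + t * q" for j q
  proof -
    define u where "u = h k - e"
    have hj: "h j = e + u - d * q" and hj1: "h (j + 1) = e - u - d * q"
    proof -
      show "h j = e + u - d * q" using charge_shift_mult[OF assms(1), of k q] j by (simp add: u_def)
      have "h (j + 1) = h (k + 1) - d * q"
        using charge_shift_mult[OF assms(1), of "k + 1" q] j by (simp add: ac_simps)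
      then show "h (j + 1) = e - u - d * q"
        using charge_middle[OF assms(1) k] e unfolding u_def by linarith
    qed
    have ex1: "2 * (d * j + t * l) = t - d \<longleftrightarrow> l + d * q = e + 1" for l
    proof -
      have "2 * (d * j + t * l) - (t - d) = 2 * t * (l + d * q - (e + 1))"
        using j e k by algebra
      then show ?thesis using t_gt_1 by auto
    qed
    have ex2: "2 * (d * (j + 1) + t * l) = t + d \<longleftrightarrow> l + d * q = e + 1" for l
    proof -
      have "2 * (d * (j + 1) + t * l) - (t + d) = 2 * t * (l + d * q - (e + 1))"
        using j e k by algebra
      then show ?thesis using t_gt_1 by auto
    qed
    have "?E j \<longleftrightarrow> (\<forall>l. l \<le> e + u - d * q \<longrightarrow> l + d * q \<noteq> e + 1 \<longrightarrow> l - 1 \<le> e - u - d * q) \<and>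
        (\<forall>l. l \<le> e - u - d * q \<longrightarrow> l + d * q \<noteq> e + 1 \<longrightarrow> l - 1 \<le> e + u - d * q)"
      unfolding ex1 ex2 hj hj1 by simp
    also have "\<dots> \<longleftrightarrow> \<bar>u\<bar> \<le> 1"
    proof
      assume A: "(\<forall>l. l \<le> e + u - d * q \<longrightarrow> l + d * q \<noteq> e + 1 \<longrightarrow> l - 1 \<le> e - u - d * q) \<and>
        (\<forall>l. l \<le> e - u - d * q \<longrightarrow> l + d * q \<noteq> e + 1 \<longrightarrow> l - 1 \<le> e + u - d * q)"
      show "\<bar>u\<bar> \<le> 1"
        using A[THEN conjunct1, rule_format, of "e + u - d * q"]
          A[THEN conjunct2, rule_format, of "e - u - d * q"] by linarith
    next
      assume "\<bar>u\<bar> \<le> 1"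
      then show "(\<forall>l. l \<le> e + u - d * q \<longrightarrow> l + d * q \<noteq> e + 1 \<longrightarrow> l - 1 \<le> e - u - d * q) \<and>
        (\<forall>l. l \<le> e - u - d * q \<longrightarrow> l + d * q \<noteq> e + 1 \<longrightarrow> l - 1 \<le> e + u - d * q)"
        by (intro conjI allI impI; linarith)
    qed
    finally show ?thesis by (simp add: u_def)
  qed
  show ?thesis
    unfolding core_pair_iff_edges[OF assms(1)]
  proof
    assume all: "\<forall>j. ?E j"
    show ?R using all regular middle[of k 0] by simp
  next
    assume R: ?R
    show "\<forall>j. ?E j"
    proof
      fix j
      show "?E j"
      proof (cases "t dvd 2 * j + 1")
        case True
        then obtain q where "j = k + t * q" using t_dvd_odd_iff[OF k] by blast
        then show ?thesis using middle R by blast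
      next
        case False
        then show ?thesis using regular R by blast
      qed
    qed
  qed
qed

lemma core_set_t_beads: "charge h \<Longrightarrow> core_set t (parts (beads h))"
  using core_set_beads[of h 1 0] by simp

section \<open>Charges from path heights\<close>

text \<open>The final height of the paths; for even \<open>d\<close> the division yields \<open>- (d div 2)\<close>.\<close>

definition terminus :: int where
  "terminus = - ((d + 1) div 2)"

definition half :: nat where
  "half = nat (t div 2)"

text \<open>The charge with prescribed values in the columns \<open>j\<close> with \<open>1 \<le> j\<close> and \<open>2 * j < t\<close>. The column
  \<open>t / 2\<close>, present for even \<open>t\<close>, is its own mirror image up to a shift, which fixes its value
  (\<open>charge_half\<close>); the value of the argument there is free to record something else.\<close>

definition extend :: "(nat \<Rightarrow> int) \<Rightarrow> int \<Rightarrow> int" where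
  "extend g j =
    (let r = j mod t in
       (if r = 0 then - 1
        else if 2 * r < t then g (nat r)
        else if 2 * r = t then terminus
        else - 1 - d - g (nat (t - r)))
     - d * (j div t))"

lemma half_pos: "1 \<le> half"
  using t_gt_1 by (simp add: half_def)

lemma half_bounds: "2 * int half \<le> t" "t \<le> 2 * int half + 1"
  using t_gt_1 by (auto simp: half_def)

lemma odd_d_if_even_t: "even t \<Longrightarrow> odd d"
  using coprime_dt by (metis coprime_common_divisor odd_one)

lemma terminus_odd: "odd d \<Longrightarrow> d = - 2 * terminus - 1"
  by (auto simp: terminus_def elim!: oddE)

lemma terminus_even: "even d \<Longrightarrow> d = - 2 * terminus"
  by (auto simp: terminus_def elim!: evenE)

lemma terminus_neg: "terminus \<le> - 1"
  using d_pos by (simp add: terminus_def)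

lemma extend_eq: "1 \<le> j \<Longrightarrow> 2 * j < t \<Longrightarrow> extend g j = g (nat j)"
  by (simp add: extend_def Let_def div_pos_pos_trivial)

lemma charge_extend: "charge (extend g)"
  unfolding charge_def
proof (intro conjI allI impI)
  show "extend g (j + t) = extend g j - d" for j
  proof -
    have "(j + t) div t = j div t + 1" using t_gt_1 by (simp add: div_add_self2)
    then show ?thesis by (simp add: extend_def Let_def algebra_simps)
  qed
  show "extend g 0 = - 1" by (simp add: extend_def)
  fix j assume nd: "\<not> t dvd j"
  define r q where "r = j mod t" and "q = j div t"
  have r: "0 < r" "r < t"
    using nd t_gt_1 pos_mod_sign[of t j] pos_mod_bound[of t j]
    by (auto simp: r_def dvd_eq_mod_eq_0 order_less_le)
  have neg: "(- j) mod t = t - r" "(- j) div t = - q - 1"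
    using nd zmod_zminus1_eq_if[of j t] zdiv_zminus1_eq_if[of t j] t_gt_1
    by (auto simp: r_def q_def dvd_eq_mod_eq_0)
  consider "2 * r < t" | "2 * r = t" | "t < 2 * r" by linarith
  then show "extend g (- j) = - 1 - extend g j"
  proof cases
    case 2
    then have "even t" by (metis dvd_triv_left)
    then have "d = - 2 * terminus - 1" using odd_d_if_even_t terminus_odd by blast
    then show ?thesis
      using 2 r unfolding extend_def Let_def neg r_def[symmetric] q_def[symmetric]
      by (simp add: algebra_simps)
  qed (use r in \<open>auto simp: extend_def Let_def neg algebra_simps simp flip: r_def q_def\<close>)
qed

lemma charge_half:
  assumes "charge h" and "2 * j = t"
  shows "h j = terminus"
proof -
  have "odd d" using odd_d_if_even_t assms(2) by (metis dvd_triv_left)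
  then have "d = - 2 * terminus - 1" by (rule terminus_odd)
  moreover have "h (- j) = - 1 - h j"
    using charge_uminus[OF assms(1) not_t_dvd[of j]] assms(2) t_gt_1 by simp
  moreover have "h j = h (- j) - d"
    using charge_shift[OF assms(1), of "- j"] assms(2) by (simp add: algebra_simps flip: assms(2))
  ultimately show ?thesis by simp
qed

text \<open>Every column is a shift or the mirror image of one of those in the hypothesis, of column \<open>0\<close> or of
  column \<open>t / 2\<close>.\<close>

lemma charge_eqI:
  assumes h: "charge h" and h': "charge h'" and eq: "\<And>j. 1 \<le> j \<Longrightarrow> 2 * j < t \<Longrightarrow> h j = h' j"
  shows "h = h'"
proof
  fix j
  define r q where "r = j mod t" and "q = j div t"
  have j: "j = r + t * q" and r: "0 \<le> r" "r < t" using t_gt_1 by (auto simp: r_def q_def)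
  consider "r = 0" | "1 \<le> r" "2 * r < t" | "2 * r = t" | "t < 2 * r" using r by linarith
  then have "h r = h' r"
  proof cases
    case 4
    have "f r = - 1 - d - f (t - r)" if "charge f" for f
    proof -
      have "f (- (t - r)) = - 1 - f (t - r)"
        using charge_uminus[OF that not_t_dvd[of "t - r"]] r 4 t_gt_1 by simp
      then show ?thesis using charge_shift[OF that, of "- (t - r)"] by simp
    qed
    from this[OF h] this[OF h'] show ?thesis using eq[of "t - r"] r 4 by simp
  qed (use eq charge_0[OF h] charge_0[OF h'] charge_half[OF h] charge_half[OF h'] in auto)
  then show "h j = h' j" using charge_shift_mult[OF h, of r q] charge_shift_mult[OF h', of r q] j by simp
qed

lemma parts_beads_inject:
  assumes "charge h" "charge h'" "parts (beads h) = parts (beads h')"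
  shows "h = h'"
proof
  fix j
  have "beads h = beads h'" using maya_beads assms by metis
  then have "l \<le> h j \<longleftrightarrow> l \<le> h' j" for l using mem_beads_iff assms(1,2) by metis
  then show "h j = h' j" by (meson order.antisym order.refl)
qed

definition cores :: "nat set set" where
  "cores = {X. finite X \<and> 0 \<notin> X \<and> core_set (t - d) X \<and> core_set t X \<and> core_set (t + d) X}"

lemma exists_charge_core:
  assumes "X \<in> cores" and "\<And>n. n \<in> maya X \<Longrightarrow> 2 * n \<noteq> t"
  obtains h where "charge h" "X = parts (beads h)"
proof -
  have "n - t \<in> maya X" if "n \<in> maya X" for n
    using assms that by (auto simp: cores_def core_set_def)
  then show ?thesis using exists_charge[of X] assms(1) that by (auto simp: cores_def)
qed

lemma parts_beads_in_cores_iff: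
  assumes "charge h"
  shows "parts (beads h) \<in> cores \<longleftrightarrow>
    core_set (t - d) (parts (beads h)) \<and> core_set (t + d) (parts (beads h))"
  using finite_parts_beads[OF assms] core_set_t_beads[OF assms] by (auto simp: cores_def)

text \<open>The heights of the paths that have the required end points and do not start with \<open>U\<close>.\<close>

definition start_ok :: "(nat \<Rightarrow> int) \<Rightarrow> bool" where
  "start_ok g \<longleftrightarrow> profile (half + 1) terminus g \<and> g 1 \<noteq> 1"

text \<open>The value at \<open>0\<close> is the starting height of the path and differs from \<open>h 0 = - 1\<close>: with the start at
  height \<open>0\<close>, the two possibilities \<open>h 1 = - 1\<close> and \<open>h 1 = 0\<close> become the steps \<open>D\<close> and \<open>F\<close>.\<close>

definition restrict :: "(int \<Rightarrow> int) \<Rightarrow> nat \<Rightarrow> int" where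
  "restrict h j = (if j = 0 then 0 else if j \<le> half then h (int j) else terminus)"

lemma extend_restrict: "charge h \<Longrightarrow> extend (restrict h) = h"
  using half_bounds by (intro charge_eqI charge_extend) (auto simp: extend_eq restrict_def)

lemma start_ok_rise: "start_ok g \<Longrightarrow> j \<le> half \<Longrightarrow> \<bar>g (Suc j) - g j\<bar> \<le> 1"
  by (simp add: start_ok_def profile_def)

lemma start_ok_0: "start_ok g \<Longrightarrow> g 0 = 0"
  by (simp add: start_ok_def profile_def)

lemma start_ok_beyond: "start_ok g \<Longrightarrow> half < j \<Longrightarrow> g j = terminus"
  by (simp add: start_ok_def profile_def)

lemma start_ok_first: "start_ok g \<Longrightarrow> g 1 = - 1 \<or> g 1 = 0"
  using start_ok_rise[of g 0] start_ok_0[of g] by (auto simp: start_ok_def)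

lemma start_ok_last: "start_ok g \<Longrightarrow> \<bar>g half - terminus\<bar> \<le> 1"
  using start_ok_rise[of g half] start_ok_beyond[of g "Suc half"] by auto

lemma start_ok_restrict:
  assumes "charge h" and "\<forall>j. \<not> t dvd 2 * j + 1 \<longrightarrow> gentle h j" and "\<bar>h (int half) - terminus\<bar> \<le> 1"
  shows "start_ok (restrict h)"
proof -
  have h1: "h 1 = - 1 \<or> h 1 = 0" and g: "\<And>j. 1 \<le> j \<Longrightarrow> 2 * j + 2 \<le> t \<Longrightarrow> gentle h j"
    using all_gentle_iff[OF assms(1)] assms(2) by blast+
  have "\<bar>restrict h (Suc j) - restrict h j\<bar> \<le> 1" if le: "j \<le> half" for j
  proof -
    consider "j = 0" | "1 \<le> j" "j < half" | "1 \<le> j" "j = half" using le by linarith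
    then show ?thesis
    proof cases
      case 1
      then show ?thesis using h1 half_pos by (auto simp: restrict_def)
    next
      case 2
      then show ?thesis using g[of "int j"] half_bounds by (auto simp: restrict_def gentle_def add.commute)
    next
      case 3
      then show ?thesis using assms(3) by (auto simp: restrict_def)
    qed
  qed
  then show ?thesis using h1 half_pos by (auto simp: start_ok_def profile_def restrict_def)
qed

lemma start_ok_eqI:
  assumes "start_ok g" "start_ok g'" "extend g = extend g'" "g half = g' half"
  shows "g = g'"
proof
  fix j
  consider "j = 0" | "1 \<le> j" "j < half" | "j = half" | "half < j" by linarith
  then show "g j = g' j"
  proof cases
    case 2
    then have "extend g (int j) = g j" "extend g' (int j) = g' j"
      using half_bounds by (auto simp: extend_eq)
    then show ?thesis using assms(3) by simp
  qed (use assms start_ok_0[of g] start_ok_0[of g'] start_ok_beyond[of g j] start_ok_beyond[of g' j]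
      in auto)
qed

lemma gentle_extend_interior:
  assumes "start_ok g" "1 \<le> j" "2 * j + 2 < t"
  shows "gentle (extend g) j"
proof -
  have "nat (j + 1) = Suc (nat j)" using assms(2) by simp
  moreover have "nat j \<le> half" using assms half_bounds by linarith
  ultimately show ?thesis
    using assms start_ok_rise[of g "nat j"] by (simp add: gentle_def extend_eq)
qed

section \<open>Odd middle bar length\<close>

text \<open>For odd \<open>t\<close> the interior pairs of columns give the same condition whatever the parity of \<open>d\<close>. The
  predicate \<open>c\<close> stands for what the middle pair requires beyond a last step of the path being possible.\<close>

lemma bij_betw_profiles_cores_odd:
  assumes "odd t"
    and char: "\<And>h. charge h \<Longrightarrow>
      core_set (t - d) (parts (beads h)) \<and> core_set (t + d) (parts (beads h)) \<longleftrightarrow>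
      (\<forall>j. \<not> t dvd 2 * j + 1 \<longrightarrow> gentle h j) \<and> \<bar>h (int half) - terminus\<bar> \<le> 1 \<and> c (h (int half))"
  shows "bij_betw (\<lambda>g. parts (beads (extend g))) {g. start_ok g \<and> c (g half)} cores"
proof -
  have t: "t = 2 * int half + 1" using half_bounds assms(1) by (auto elim!: oddE)
  have half: "extend g (int half) = g half" for g using half_pos t by (simp add: extend_eq)
  show ?thesis
    unfolding bij_betw_def
  proof (intro conjI inj_onI equalityI subsetI)
    fix g g' assume "g \<in> {g. start_ok g \<and> c (g half)}" "g' \<in> {g. start_ok g \<and> c (g half)}"
      and eq: "parts (beads (extend g)) = parts (beads (extend g'))"
    then have ok: "start_ok g" "start_ok g'" by auto
    have "extend g = extend g'" using parts_beads_inject charge_extend eq by blast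
    then show "g = g'" using start_ok_eqI[OF ok] half by metis
  next
    fix X assume "X \<in> (\<lambda>g. parts (beads (extend g))) ` {g. start_ok g \<and> c (g half)}"
    then obtain g where X: "X = parts (beads (extend g))" and g: "start_ok g" "c (g half)" by blast
    have "extend g 1 = - 1 \<or> extend g 1 = 0"
      using start_ok_first[OF g(1)] t half_pos by (simp add: extend_eq)
    moreover have "gentle (extend g) j" if "1 \<le> j" "2 * j + 2 \<le> t" for j
    proof -
      have "2 * j + 2 < t" using that(2) t by presburger
      then show ?thesis using gentle_extend_interior g(1) that(1) by blast
    qed
    ultimately have "\<forall>j. \<not> t dvd 2 * j + 1 \<longrightarrow> gentle (extend g) j"
      using all_gentle_iff[OF charge_extend] by blast
    then show "X \<in> cores"
      unfolding X parts_beads_in_cores_iff[OF charge_extend] char[OF charge_extend] half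
      using g start_ok_last by blast
  next
    fix X assume X: "X \<in> cores"
    have "2 * n \<noteq> t" for n using assms(1) by (metis dvd_triv_left)
    then obtain h where h: "charge h" "X = parts (beads h)" using exists_charge_core[OF X] by metis
    then have *: "(\<forall>j. \<not> t dvd 2 * j + 1 \<longrightarrow> gentle h j) \<and> \<bar>h (int half) - terminus\<bar> \<le> 1 \<and> c (h (int half))"
      using X char[OF h(1)] parts_beads_in_cores_iff[OF h(1)] by blast
    have "restrict h half = h (int half)" using half_pos by (simp add: restrict_def)
    then have "restrict h \<in> {g. start_ok g \<and> c (g half)}"
      using start_ok_restrict[OF h(1)] * by auto
    moreover have "X = parts (beads (extend (restrict h)))"
      using h extend_restrict by simp
    ultimately show "X \<in> (\<lambda>g. parts (beads (extend g))) ` {g. start_ok g \<and> c (g half)}" by blast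
  qed
qed

lemma bij_betw_profiles_cores_odd_even:
  assumes "odd t" "even d"
  shows "bij_betw (\<lambda>g. parts (beads (extend g)))
    {g. start_ok g \<and> g half \<noteq> terminus + 1} cores"
proof (rule bij_betw_profiles_cores_odd[OF assms(1)])
  fix h assume h: "charge h"
  have t: "t = 2 * int half + 1" using half_bounds assms(1) by (auto elim!: oddE)
  have "odd (t - d)" using assms by simp
  then show "core_set (t - d) (parts (beads h)) \<and> core_set (t + d) (parts (beads h)) \<longleftrightarrow>
      (\<forall>j. \<not> t dvd 2 * j + 1 \<longrightarrow> gentle h j) \<and> \<bar>h (int half) - terminus\<bar> \<le> 1 \<and> h (int half) \<noteq> terminus + 1"
    unfolding core_pair_iff_gentle[OF h \<open>odd (t - d)\<close>]
      all_gentle_odd_iff[OF h t terminus_even[OF assms(2)]] by auto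
qed

lemma bij_betw_profiles_cores_odd_odd:
  assumes "odd t" "odd d"
  shows "bij_betw (\<lambda>g. parts (beads (extend g))) {g. start_ok g} cores"
proof -
  have t: "t = 2 * int half + 1" using half_bounds assms(1) by (auto elim!: oddE)
  show ?thesis
    using bij_betw_profiles_cores_odd[OF assms(1), of "\<lambda>_. True"]
      core_pair_iff_gentle_exceptional[OF _ t terminus_odd[OF assms(2)]] by simp
qed

section \<open>Even middle bar length\<close>

text \<open>The last step is not \<open>U\<close>, and if it is \<open>D\<close> then it follows a step \<open>U\<close>.\<close>

definition end_ok :: "(nat \<Rightarrow> int) \<Rightarrow> bool" where
  "end_ok g \<longleftrightarrow> g half \<noteq> terminus - 1 \<and> (g half = terminus + 1 \<longrightarrow> g (half - 1) = terminus)"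

text \<open>The charge cannot record whether \<open>t / 2\<close> is a part, since its value in that column is forced. The height
  at \<open>half\<close> carries this information instead.\<close>

definition core_of :: "(nat \<Rightarrow> int) \<Rightarrow> nat set" where
  "core_of g = (if g half = terminus then {} else {half}) \<union> parts (beads (extend g))"

lemma even_t: "even t \<Longrightarrow> t = 2 * int half"
  using half_bounds by (auto elim!: evenE)

lemma odd_core_lengths: "even t \<Longrightarrow> 2 * m \<noteq> t - d \<and> 2 * m \<noteq> t + d"
  using odd_d_if_even_t by (metis dvd_triv_left even_add even_diff)

lemma half_not_in_parts_beads:
  assumes "even t" "charge h"
  shows "half \<notin> parts (beads h)"
proof -
  have "d = - 2 * terminus - 1" using odd_d_if_even_t[OF assms(1)] terminus_odd by blast
  then have "2 * int half = 2 * (d * int half + t * (terminus + 1))"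
    using even_t[OF assms(1)] by algebra
  then have "int half = d * int half + t * (terminus + 1)" by simp
  moreover have "h (int half) = terminus" using charge_half assms even_t by metis
  ultimately have "int half \<notin> beads h"
    using mem_beads_iff[OF assms(2), of "int half" "terminus + 1"] by simp
  then show ?thesis by (simp add: parts_def)
qed

text \<open>If \<open>k = t / 2\<close> is a part, then \<open>d - k\<close> and \<open>- k - d\<close> are in the encoding by the moves of \<open>k\<close>, so
  \<open>k - d\<close> and \<open>k + d\<close> are not. Each of \<open>k + t\<close>, \<open>k + t - d\<close> and \<open>k + t + d\<close> would move to one of
  these, so none of them occurs, and therefore \<open>k\<close> can be removed. In particular \<open>t / 2\<close> is the only part
  in its column.\<close>

lemma remove_half_core:
  assumes "even t" "X \<in> cores" "half \<in> X"
  shows "X - {half} \<in> cores \<and> d - int half \<in> maya (X - {half}) \<and> - int half - d \<in> maya (X - {half})"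
proof -
  let ?k = "int half"
  note t = even_t[OF assms(1)]
  have closed: "n \<in> maya X \<Longrightarrow> 2 * n \<noteq> t \<Longrightarrow> n - t \<in> maya X"
    "n \<in> maya X \<Longrightarrow> n - (t - d) \<in> maya X" "n \<in> maya X \<Longrightarrow> n - (t + d) \<in> maya X" for n
    using assms(2) odd_core_lengths[OF assms(1), of n] by (auto simp: cores_def core_set_def)
  have k: "?k \<in> maya X" using assms(3) half_pos int_mem_maya by simp
  have neg: "d - ?k \<in> maya X" "- ?k - d \<in> maya X"
  proof -
    have "?k - (t - d) = d - ?k" "?k - (t + d) = - ?k - d" using t by linarith+
    then show "d - ?k \<in> maya X" "- ?k - d \<in> maya X" using closed(2,3)[OF k] by metis+
  qed
  have "d - ?k \<noteq> 0" using neg(1) by (metis zero_not_maya)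
  then have pos: "?k - d \<notin> maya X" "?k + d \<notin> maya X"
    using neg maya_uminus_iff[of "d - ?k" X] maya_uminus_iff[of "- ?k - d" X] d_pos by (auto simp: add.commute)
  have "?k + t \<notin> maya X" using closed(2)[of "?k + t"] pos by auto
  moreover have "?k + (t - d) \<notin> maya X"
    using closed(1)[of "?k + (t - d)"] pos d_less_t t by auto
  moreover have "?k + (t + d) \<notin> maya X"
    using closed(1)[of "?k + (t + d)"] pos d_pos t_gt_1 t by (auto simp: algebra_simps)
  ultimately have "X - {half} \<in> cores"
    using assms(2) core_set_remove[of _ X half] half_pos d_pos d_less_t by (auto simp: cores_def)
  then show ?thesis
    using neg maya_remove[of half X] half_pos d_pos d_less_t t by auto
qed

lemma insert_half_core:
  assumes "even t" "X \<in> cores" "half \<notin> X" "d - int half \<in> maya X" "- int half - d \<in> maya X"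
  shows "insert half X \<in> cores"
proof -
  have "int half - (t - d) \<in> maya X" "int half - (t + d) \<in> maya X"
  proof -
    have "int half - (t - d) = d - int half" "int half - (t + d) = - int half - d"
      using even_t[OF assms(1)] by linarith+
    then show "int half - (t - d) \<in> maya X" "int half - (t + d) \<in> maya X" using assms(4,5) by metis+
  qed
  then show ?thesis
    using assms(2,3) core_set_insert[of _ X half] half_pos even_t[OF assms(1)]
    by (auto simp: cores_def)
qed

text \<open>The two integers lie in the columns \<open>1 - k\<close> and \<open>- 1 - k\<close>, where \<open>k = t / 2\<close>. Reflected
  and shifted to column \<open>k - 1\<close>, their presence bounds \<open>h (k - 1)\<close> by \<open>terminus\<close> from
  above and from below. For \<open>t = 2\<close> the first integer is \<open>0\<close>, which is never present.\<close>

lemma half_insertable_iff: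
  assumes "even t" "charge h"
  shows "d - int half \<in> beads h \<and> - int half - d \<in> beads h \<longleftrightarrow>
    2 \<le> half \<and> h (int half - 1) = terminus"
proof (cases "2 \<le> half")
  case True
  let ?k = "int half"
  note t = even_t[OF assms(1)]
  have d: "d = - 2 * terminus - 1" using odd_d_if_even_t[OF assms(1)] terminus_odd by blast
  \<comment> \<open>Doubling avoids the halves of \<open>t\<close> and of \<open>d - 1\<close> in the coordinates of the two integers.\<close>
  have "2 * (d - ?k) = 2 * (d * (- (?k - 1)) + t * (- terminus - 1))" using t d by algebra
  then have 1: "d - ?k = d * (- (?k - 1)) + t * (- terminus - 1)" by simp
  have "2 * (- ?k - d) = 2 * (d * (- 1 - ?k) + t * (- terminus - 1))" using t d by algebra
  then have 2: "- ?k - d = d * (- 1 - ?k) + t * (- terminus - 1)" by simp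
  have "h (- (?k - 1)) = - 1 - h (?k - 1)"
    using charge_uminus[OF assms(2) not_t_dvd[of "?k - 1"]] True t by simp
  moreover have "h (?k - 1) = h (- 1 - ?k) - d"
  proof -
    have "- 1 - ?k + t = ?k - 1" using t by linarith
    then show ?thesis using charge_shift[OF assms(2), of "- 1 - ?k"] by metis
  qed
  ultimately show ?thesis
    unfolding 1 2 mem_beads_iff[OF assms(2)] using True d by auto
next
  case False
  then have "half = 1" using half_pos by simp
  then have "d - int half = 0" using even_t[OF assms(1)] d_pos d_less_t by simp
  then have "d - int half \<notin> beads h" using maya_beads[OF assms(2)] zero_not_maya by metis
  then show ?thesis using False by blast
qed

text \<open>The heights of the path and the charge may differ at \<open>half\<close>, where the charge has the value
  \<open>terminus\<close>. In that case \<open>end_ok\<close> makes the charge constant on the last pair of columns.\<close>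

lemma all_gentle_extend_even:
  assumes "even t" "start_ok g" "end_ok g"
  shows "gentle (extend g) j"
proof -
  note t = even_t[OF assms(1)]
  have h: "extend g (int half) = terminus" using charge_half[OF charge_extend] t by simp
  have last: "g half = terminus \<or> g half = terminus + 1 \<and> g (half - 1) = terminus"
    using start_ok_last[OF assms(2)] assms(3) by (auto simp: end_ok_def)
  have "extend g 1 = g 1"
  proof (cases "half = 1")
    case True
    then have "g half = terminus"
      using last start_ok_0[OF assms(2)] terminus_neg by auto
    then show ?thesis using h True by simp
  next
    case False
    then show ?thesis using half_pos t by (simp add: extend_eq)
  qed
  then have "extend g 1 = - 1 \<or> extend g 1 = 0" using start_ok_first[OF assms(2)] by simp
  moreover have "gentle (extend g) i" if "1 \<le> i" "2 * i + 2 \<le> t" for i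
  proof (cases "2 * i + 2 = t")
    case True
    then have i: "i = int (half - 1)" "i + 1 = int half" using t half_pos by auto
    then have "nat i = half - 1" by simp
    moreover have "extend g i = g (nat i)" using that(1) i(2) t by (intro extend_eq) auto
    ultimately have "extend g i = g (half - 1)" by metis
    moreover have "\<bar>g half - g (half - 1)\<bar> \<le> 1"
      using start_ok_rise[OF assms(2), of "half - 1"] half_pos by simp
    ultimately show ?thesis unfolding gentle_def i(2) h using last by auto
  next
    case False
    then show ?thesis using gentle_extend_interior assms(2) that by simp
  qed
  moreover have "\<not> t dvd 2 * j + 1" 
  proof
    assume "t dvd 2 * j + 1"
    then have "even (2 * j + 1)" using assms(1) dvd_trans by blast
    then show False by simp
  qed
  ultimately show ?thesis using all_gentle_iff[OF charge_extend] by blast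
qed

lemma half_in_core_of_iff: "even t \<Longrightarrow> half \<in> core_of g \<longleftrightarrow> g half \<noteq> terminus"
  using half_not_in_parts_beads[OF _ charge_extend] by (simp add: core_of_def)

lemma core_of_minus_half: "even t \<Longrightarrow> core_of g - {half} = parts (beads (extend g))"
  using half_not_in_parts_beads[OF _ charge_extend] by (auto simp: core_of_def)

lemma parts_beads_in_cores_even_iff:
  assumes "even t" "charge h"
  shows "parts (beads h) \<in> cores \<longleftrightarrow> (\<forall>j. gentle h j)"
proof -
  have "odd (t - d)" using assms(1) odd_d_if_even_t by simp
  then show ?thesis using parts_beads_in_cores_iff core_pair_iff_gentle assms(2) by blast
qed

lemma core_of_in_cores:
  assumes "even t" "start_ok g" "end_ok g"
  shows "core_of g \<in> cores"
proof -
  note t = even_t[OF assms(1)]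
  have base: "parts (beads (extend g)) \<in> cores"
    using parts_beads_in_cores_even_iff[OF assms(1) charge_extend] all_gentle_extend_even[OF assms]
    by blast
  show ?thesis
  proof (cases "g half = terminus")
    case True
    then show ?thesis using base by (simp add: core_of_def)
  next
    case False
    then have last: "g (half - 1) = terminus"
      using start_ok_last[OF assms(2)] assms(3) by (auto simp: end_ok_def)
    have "half \<noteq> 1" using last start_ok_0[OF assms(2)] terminus_neg by auto
    then have two: "2 \<le> half" using half_pos by simp
    then have "nat (int half - 1) = half - 1" by simp
    then have "extend g (int half - 1) = terminus" using last two t by (simp add: extend_eq)
    then have "d - int half \<in> beads (extend g) \<and> - int half - d \<in> beads (extend g)"
      using half_insertable_iff[OF assms(1) charge_extend] two by blast
    then have "insert half (parts (beads (extend g))) \<in> cores"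
      using insert_half_core[OF assms(1) base] half_not_in_parts_beads[OF assms(1) charge_extend]
        maya_beads[OF charge_extend] by metis
    then show ?thesis using False by (simp add: core_of_def)
  qed
qed

text \<open>Removing the part \<open>t / 2\<close>, if present, leaves a core that comes from a charge. Its heights
  form the profile, raised by \<open>1\<close> at \<open>half\<close> if that part was removed.\<close>

lemma core_of_surj:
  assumes "even t" "X \<in> cores"
  shows "\<exists>g. start_ok g \<and> end_ok g \<and> core_of g = X"
proof -
  note t = even_t[OF assms(1)]
  define X0 where "X0 = X - {half}"
  have X0: "X0 \<in> cores"
    using assms(2) remove_half_core[OF assms] unfolding X0_def by (cases "half \<in> X") auto
  have "2 * n \<noteq> t" if "n \<in> maya X0" for n
    using that t half_pos int_mem_maya[of half X0] by (auto simp: X0_def)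
  then obtain h where h: "charge h" "X0 = parts (beads h)" using exists_charge_core[OF X0] by metis
  then have gentle: "gentle h j" for j using parts_beads_in_cores_even_iff[OF assms(1)] X0 by blast
  have h_half: "h (int half) = terminus" using charge_half[OF h(1)] t by simp
  have r_half: "restrict h half = terminus" using h_half half_pos by (simp add: restrict_def)
  have ok: "start_ok (restrict h)" using start_ok_restrict[OF h(1)] gentle h_half by simp
  have ext: "extend (restrict h) = h" by (rule extend_restrict[OF h(1)])
  show ?thesis
  proof (cases "half \<in> X")
    case False
    then have "core_of (restrict h) = X" using ext h(2) r_half by (simp add: core_of_def X0_def)
    moreover have "end_ok (restrict h)" using r_half by (simp add: end_ok_def)
    ultimately show ?thesis using ok by blast
  next
    case True
    define g where "g = (restrict h)(half := terminus + 1)"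
    have "2 \<le> half \<and> h (int half - 1) = terminus"
      using remove_half_core[OF assms True] half_insertable_iff[OF assms(1) h(1)]
        maya_beads[OF h(1)] h(2) by (simp add: X0_def)
    then have two: "2 \<le> half" and "restrict h (half - 1) = terminus"
      by (auto simp: restrict_def of_nat_diff)
    then have prev: "g (half - 1) = terminus" by (simp add: g_def)
    have "\<bar>g (Suc j) - g j\<bar> \<le> 1" if le: "j \<le> half" for j
    proof -
      consider "Suc j < half" | "Suc j = half" | "j = half" using le by linarith
      then show ?thesis
      proof cases
        case 1
        then show ?thesis using start_ok_rise[OF ok, of j] by (simp add: g_def)
      next
        case 2
        then have "j = half - 1" by simp
        then have "g j = terminus" using prev by simp
        then show ?thesis using 2 by (simp add: g_def)
      next
        case 3
        then show ?thesis using start_ok_beyond[OF ok, of "Suc j"] by (simp add: g_def)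
      qed
    qed
    then have "start_ok g"
      using ok two by (auto simp: start_ok_def profile_def g_def)
    moreover have "end_ok g" using prev by (simp add: end_ok_def g_def)
    moreover have "extend g = h"
      using ext t by (intro charge_eqI charge_extend h(1)) (auto simp: extend_eq g_def restrict_def)
    then have "core_of g = X" using h(2) True by (auto simp: core_of_def g_def X0_def)
    ultimately show ?thesis by blast
  qed
qed

lemma bij_betw_core_of:
  assumes "even t"
  shows "bij_betw core_of {g. start_ok g \<and> end_ok g} cores"
proof -
  have "inj_on core_of {g. start_ok g \<and> end_ok g}"
  proof (rule inj_onI, clarify)
    fix g g' assume g: "start_ok g" "end_ok g" and g': "start_ok g'" "end_ok g'"
      and eq: "core_of g = core_of g'"
    have "extend g = extend g'"
      using core_of_minus_half[OF assms] eq parts_beads_inject charge_extend by metis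
    moreover have "g half = terminus \<or> g half = terminus + 1" "g' half = terminus \<or> g' half = terminus + 1"
      using start_ok_last[OF g(1)] start_ok_last[OF g'(1)] g(2) g'(2) by (auto simp: end_ok_def)
    moreover have "g half = terminus \<longleftrightarrow> g' half = terminus"
      using half_in_core_of_iff[OF assms] eq by metis
    ultimately have "extend g = extend g'" "g half = g' half" by auto
    then show "g = g'" using start_ok_eqI g(1) g'(1) by blast
  qed
  moreover have "core_of ` {g. start_ok g \<and> end_ok g} = cores"
    using core_of_in_cores[OF assms] core_of_surj[OF assms] by blast
  ultimately show ?thesis by (simp add: bij_betw_def)
qed

section \<open>Forbidden beginnings and endings as conditions on heights\<close>

lemma bij_betw_height_avoiding:
  assumes "\<And>p. length p = half + 1 \<Longrightarrow> start_ok (height p) \<Longrightarrow>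
    (\<forall>b\<in>B. \<not> suffix b p) \<longleftrightarrow> Q (height p)"
  shows "bij_betw height (motzkin_paths_avoiding (int (half + 1)) terminus {[U]} B)
    {g. start_ok g \<and> Q g}"
proof -
  have rise: "snd (step_vec x) = 1 \<longleftrightarrow> x = U" for x by (cases x) auto
  have "prefix [U] p \<longleftrightarrow> height p 1 = 1" if "length p = half + 1" for p
  proof -
    have "height p 1 = snd (step_vec (p ! 0))" using height_Suc[of 0 p] that by simp
    moreover have "p \<noteq> []" using that by auto
    ultimately show ?thesis using rise[of "p ! 0"] by (simp add: prefix_single_iff)
  qed
  then have start: "start_ok (height p) \<longleftrightarrow> \<not> prefix [U] p"
    if "free_motzkin_path (int (half + 1)) terminus p" for p
    using that unfolding free_motzkin_path_iff start_ok_def by blast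
  have eq: "p \<in> motzkin_paths_avoiding (int (half + 1)) terminus {[U]} B \<longleftrightarrow>
      free_motzkin_path (int (half + 1)) terminus p \<and> start_ok (height p) \<and> Q (height p)" for p
    using assms[of p] start[of p] free_motzkin_path_iff[of "half + 1" terminus p]
    unfolding motzkin_paths_avoiding_def by blast
  show ?thesis
  proof (rule bij_betw_subset[OF bij_betw_height[of "half + 1" terminus]])
    show "height ` motzkin_paths_avoiding (int (half + 1)) terminus {[U]} B = {g. start_ok g \<and> Q g}"
    proof -
      have "g \<in> height ` {p. free_motzkin_path (int (half + 1)) terminus p}" if "start_ok g" for g
        using bij_betw_imp_surj_on[OF bij_betw_height[of "half + 1" terminus]] that
        unfolding start_ok_def by blast
      then show ?thesis using eq by blast
    qed
  qed (use eq in blast)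
qed

lemma last_step:
  assumes "length p = half + 1" "start_ok (height p)"
  shows "p ! half = step_of_rise (terminus - height p half)"
  using nth_eq_step_of_rise[of half p] start_ok_beyond[OF assms(2), of "Suc half"] assms(1) by simp

lemma avoiding_D_iff:
  assumes "length p = half + 1" "start_ok (height p)"
  shows "(\<forall>b\<in>{[D]}. \<not> suffix b p) \<longleftrightarrow> height p half \<noteq> terminus + 1"
  using start_ok_last[OF assms(2)] assms(1) last_step[OF assms]
  by (auto simp: suffix_single_iff step_of_rise_def split: if_splits)

lemma avoiding_FD_DD_U_iff:
  assumes "length p = half + 1" "start_ok (height p)"
  shows "(\<forall>b\<in>{[F, D], [D, D], [U]}. \<not> suffix b p) \<longleftrightarrow> end_ok (height p)"
proof -
  have "Suc (half - 1) = half" using half_pos by simp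
  then have "p ! (half - 1) = step_of_rise (height p half - height p (half - 1))"
    using nth_eq_step_of_rise[of "half - 1" p] assms(1) by simp
  moreover have "\<bar>height p half - height p (half - 1)\<bar> \<le> 1"
    using start_ok_rise[OF assms(2), of "half - 1"] \<open>Suc (half - 1) = half\<close> by simp
  moreover have "p \<noteq> []" "2 \<le> length p" "length p - 2 = half - 1" "length p - 1 = half"
    using assms(1) half_pos by auto
  ultimately show ?thesis
    using start_ok_last[OF assms(2)] last_step[OF assms]
    by (auto simp: suffix_single_iff suffix_pair_iff step_of_rise_def end_ok_def split: if_splits)
qed

end

lemma bij_betw_common_target:
  assumes "bij_betw a A C" "bij_betw b B C"
  shows "\<exists>f. bij_betw f A B"
  using assms bij_betw_inv bij_betw_trans by metis

theorem theorem4p7: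
  fixes s d :: nat
  assumes "s > 0" and "d > 0" and "coprime s d"
  shows "(odd s \<and> even d \<longrightarrow>
           (\<exists>f. bij_betw f (BC s (s + d) (s + 2 * d))
                 (motzkin_paths_avoiding ((int s + int d + 1) div 2) (- (int d div 2))
                    {[U]} {[D]})))
       \<and> (odd s \<and> odd d \<longrightarrow>
           (\<exists>f. bij_betw f (BC s (s + d) (s + 2 * d))
                 (motzkin_paths_avoiding ((int s + int d + 2) div 2) (- ((int d + 1) div 2))
                    {[U]} {[F, D], [D, D], [U]})))
       \<and> (even s \<and> odd d \<longrightarrow>
           (\<exists>f. bij_betw f (BC s (s + d) (s + 2 * d))
                 (motzkin_paths_avoiding ((int s + int d + 1) div 2) (- ((int d + 1) div 2))
                    {[U]} {})))"
proof -
  interpret abacus "int s + int d" "int d"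
  proof
    have "coprime d (d + s)" using assms(3) by (simp add: coprime_iff_gcd_eq_1 gcd.commute)
    then show "coprime (int d) (int s + int d)"
      by (metis add.commute coprime_int_iff of_nat_add)
  qed (use assms in auto)
  have BC: "bij_betw set (BC s (s + d) (s + 2 * d)) cores"
  proof -
    have lengths: "int s + int d - int d = int s" "int s + int d + int d = int (s + 2 * d)"
      and middle: "int s + int d = int (s + d)" by simp_all
    show ?thesis
      unfolding cores_def lengths unfolding middle by (rule bij_betw_set_BC) (use assms in auto)
  qed
  have transfer: "\<exists>f. bij_betw f (BC s (s + d) (s + 2 * d))
      (motzkin_paths_avoiding (int (half + 1)) terminus {[U]} B)"
    if "bij_betw \<Phi> {g. start_ok g \<and> Q g} cores"
      and "\<And>p. length p = half + 1 \<Longrightarrow> start_ok (height p) \<Longrightarrow> (\<forall>b\<in>B. \<not> suffix b p) \<longleftrightarrow> Q (height p)"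
    for \<Phi> Q B
    using bij_betw_common_target[OF BC bij_betw_trans[OF bij_betw_height_avoiding[of B Q] that(1)]]
      that(2) by blast
  have len_odd: "(int s + int d + 1) div 2 = int (half + 1)" if "odd (int s + int d)"
    using that half_bounds by (auto elim!: oddE simp: half_def)
  show ?thesis
  proof (intro conjI impI)
    assume "odd s \<and> even d"
    then have par: "odd (int s + int d)" "even (int d)" by auto
    then have ends: "- (int d div 2) = terminus" by (auto simp: terminus_def elim!: evenE)
    show "\<exists>f. bij_betw f (BC s (s + d) (s + 2 * d))
        (motzkin_paths_avoiding ((int s + int d + 1) div 2) (- (int d div 2)) {[U]} {[D]})"
      unfolding ends len_odd[OF par(1)]
      by (rule transfer[OF bij_betw_profiles_cores_odd_even[OF par]]) (rule avoiding_D_iff)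
  next
    assume "odd s \<and> odd d"
    then have par: "even (int s + int d)" by simp
    then have len: "(int s + int d + 2) div 2 = int (half + 1)" by (auto simp: half_def)
    show "\<exists>f. bij_betw f (BC s (s + d) (s + 2 * d))
        (motzkin_paths_avoiding ((int s + int d + 2) div 2) (- ((int d + 1) div 2))
          {[U]} {[F, D], [D, D], [U]})"
      unfolding terminus_def[symmetric] len
      by (rule transfer[OF bij_betw_core_of[OF par]]) (rule avoiding_FD_DD_U_iff)
  next
    assume "even s \<and> odd d"
    then have par: "odd (int s + int d)" "odd (int d)" by auto
    have "bij_betw (\<lambda>g. parts (beads (extend g))) {g. start_ok g \<and> True} cores"
      using bij_betw_profiles_cores_odd_odd[OF par] by simp
    then show "\<exists>f. bij_betw f (BC s (s + d) (s + 2 * d))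
        (motzkin_paths_avoiding ((int s + int d + 1) div 2) (- ((int d + 1) div 2)) {[U]} {})"
      unfolding terminus_def[symmetric] len_odd[OF par(1)] by (rule transfer) simp
  qed
qed

end
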